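(* Let $q$ be a prime power, and let $k\ge 2$ and $d$ be integers with $d$ even and $4\le d\le 2k$. For integers $v$ with $k\le v-k$ consider the ratio $$g(v)=\frac{q^{(v-k)(k-d/2+1)}}{\left[{v\atop k}\right]_q\Big/\left[{v-k+d/2-1\atop d/2-1}\right]_q},$$ of the size of a lifted MRD code and the Anticode bound. Then, as $v\to\infty$, $g(v)$ is monotonically decreasing and converges to $$\frac{(1/q;1/q)_k}{(1/q;1/q)_{d/2-1}}\ \ge\ \frac{q}{q-1}\cdot(1/q;1/q)_k\ \ge\ 2\cdot(1/2;1/2)_\infty\ >\ 0.577576.$$
   Context: $\left[{v\atop k}\right]_q=\prod_{i=1}^{k}\frac{q^{v-k+i}-1}{q^i-1}$ is the $q$-binomial coefficient. The $q$-Pochhammer symbol is $(a;q)_n=\prod_{i=0}^{n-1}(1-aq^i)$, so $(1/q;1/q)_n=\prod_{i=1}^{n}(1-q^{-i})$, and $(1/q;1/q)_\infty=\lim_{n\to\infty}(1/q;1/q)_n$. For $k\le v-k$ and even $d\le 2k$, a lifted MRD code of $k$-dimensional subspaces of $\mathbb{F}_q^v$ with subspace distance $d$ has size $q^{(v-k)(k-d/2+1)}$, and the Anticode bound on the maximum size of a set of $k$-dimensional subspaces of $\mathbb{F}_q^v$ with pairwise subspace distance at least $d$ is $\left[{v\atop k}\right]_q/\left[{v-k+d/2-1\atop d/2-1}\right]_q$. *)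

theory Defs
  imports Complex_Main "HOL-Number_Theory.Prime_Powers"
begin

definition q_binomial :: "real \<Rightarrow> nat \<Rightarrow> nat \<Rightarrow> real" where
  "q_binomial q v k = (\<Prod>i = 1..k. (q ^ (v - k + i) - 1) / (q ^ i - 1))"

definition q_pochhammer :: "real \<Rightarrow> real \<Rightarrow> nat \<Rightarrow> real" where
  "q_pochhammer a q n = (\<Prod>i<n. 1 - a * q ^ i)"

definition q_pochhammer_inf :: "real \<Rightarrow> real \<Rightarrow> real" where
  "q_pochhammer_inf a q = lim (\<lambda>n. q_pochhammer a q n)"

(* The formulas below are meant for 2 * k \<le> v and even d with 4 \<le> d \<le> 2 * k;
   there no natural-number subtraction is truncated. *)

definition lifted_mrd_size :: "nat \<Rightarrow> nat \<Rightarrow> nat \<Rightarrow> nat \<Rightarrow> real" where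
  "lifted_mrd_size q k d v = real q ^ ((v - k) * (k - d div 2 + 1))"

definition anticode_bound :: "nat \<Rightarrow> nat \<Rightarrow> nat \<Rightarrow> nat \<Rightarrow> real" where
  "anticode_bound q k d v =
     q_binomial (real q) v k / q_binomial (real q) (v - k + d div 2 - 1) (d div 2 - 1)"

definition mrd_anticode_ratio :: "nat \<Rightarrow> nat \<Rightarrow> nat \<Rightarrow> nat \<Rightarrow> real" where
  "mrd_anticode_ratio q k d v = lifted_mrd_size q k d v / anticode_bound q k d v"

end

theory Submission
  imports Defs
begin

text \<open>
  Put $m = v - k$ and $e = d/2 - 1$. The factors with $i \le e$ cancel in the Anticode bound, so
  $g(v) = \prod_{i=e+1}^{k} (1 - q^{-i}) / (1 - q^{-(m+i)})$. Each factor decreases in $m$ and tends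
  to $1 - q^{-i}$. The first lower bound keeps only the first factor of $(1/q;1/q)_e$; the second
  compares $\prod_{i=2}^{k} (1 - q^{-i})$ factorwise with the case $q = 2$. The number is obtained
  from $\prod_{i=N+1}^{n} (1 - 2^{-i}) \ge 1 - \sum_{i=N+1}^{n} 2^{-i}$ with $N = 16$.
\<close>

lemma q_pochhammer_self_eq_prod: "q_pochhammer x x n = (\<Prod>i = 1..n. 1 - x ^ i)"
proof -
  have "(\<Prod>i<n. 1 - x * x ^ i) = (\<Prod>i = Suc 0..n. 1 - x ^ i)"
    by (rule prod.reindex_bij_witness [of _ "\<lambda>i. i - 1" Suc]) auto
  then show ?thesis
    by (simp add: q_pochhammer_def)
qed

lemma q_pochhammer_self_Suc: "q_pochhammer x x (Suc n) = q_pochhammer x x n * (1 - x ^ Suc n)"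
  by (simp add: q_pochhammer_def)

lemma q_pochhammer_self_pos:
  assumes "0 \<le> x" "x < 1"
  shows "0 < q_pochhammer x x n"
  unfolding q_pochhammer_self_eq_prod
  using assms by (intro prod_pos) (simp add: power_less_one_iff)

lemma q_pochhammer_self_antimono:
  assumes "0 \<le> x" "x < 1"
  shows "antimono (q_pochhammer x x)"
proof (rule decseq_SucI)
  fix n
  have "1 - x ^ Suc n \<le> 1"
    using assms by simp
  then show "q_pochhammer x x (Suc n) \<le> q_pochhammer x x n"
    unfolding q_pochhammer_self_Suc
    using q_pochhammer_self_pos [OF assms, of n] mult_left_le less_imp_le by blast
qed

text \<open>A decreasing sequence bounded below by 0 converges, so the \<open>lim\<close> in
  \<open>q_pochhammer_inf\<close> denotes a genuine limit.\<close>

lemma q_pochhammer_self_LIMSEQ: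
  assumes "0 \<le> x" "x < 1"
  shows "q_pochhammer x x \<longlonglongrightarrow> q_pochhammer_inf x x"
proof -
  have "convergent (q_pochhammer x x)"
    using decseq_convergent [OF q_pochhammer_self_antimono [OF assms], of 0]
      q_pochhammer_self_pos [OF assms] less_imp_le convergent_def by metis
  then show ?thesis
    by (simp add: q_pochhammer_inf_def convergent_LIMSEQ_iff)
qed

lemma q_pochhammer_inf_self_le:
  assumes "0 \<le> x" "x < 1"
  shows "q_pochhammer_inf x x \<le> q_pochhammer x x n"
  using decseq_ge q_pochhammer_self_antimono q_pochhammer_self_LIMSEQ assms by blast

text \<open>The last factor on the left is one minus the geometric sum of \<open>(1/2) ^ i\<close>
  for N < i \<le> n. Keeping the term \<open>(1/2) ^ n\<close> lets the induction close.\<close>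

lemma q_pochhammer_half_ge:
  assumes "N \<le> n"
  shows "q_pochhammer (1/2) (1/2) N * (1 - (1/2) ^ N + (1/2) ^ n) \<le> q_pochhammer (1/2) (1/2) n"
  using assms
proof (induction n rule: dec_induct)
  case base
  then show ?case by simp
next
  case (step n)
  let ?h = "\<lambda>n. (1/2 :: real) ^ n" and ?P = "q_pochhammer (1/2) (1/2)"
  \<comment> \<open>This is the cross term left over when the bound for \<open>n\<close> is
    multiplied by the next factor; discarding it gives the bound for \<open>Suc n\<close>.\<close>
  have "0 \<le> (?h N - ?h n) * ?h (Suc n)"
    using step.hyps by (simp add: power_decreasing)
  moreover have "(1 - ?h N + ?h n) * (1 - ?h (Suc n)) =
      1 - ?h N + ?h (Suc n) + (?h N - ?h n) * ?h (Suc n)"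
    by (simp add: field_simps)
  ultimately have "1 - ?h N + ?h (Suc n) \<le> (1 - ?h N + ?h n) * (1 - ?h (Suc n))"
    by linarith
  then have "?P N * (1 - ?h N + ?h (Suc n)) \<le> ?P N * ((1 - ?h N + ?h n) * (1 - ?h (Suc n)))"
    by (intro mult_left_mono less_imp_le [OF q_pochhammer_self_pos]) auto
  also have "\<dots> = ?P N * (1 - ?h N + ?h n) * (1 - ?h (Suc n))"
    by (simp only: mult.assoc)
  also have "\<dots> \<le> ?P n * (1 - ?h (Suc n))"
    by (intro mult_right_mono step.IH) (simp add: power_le_one del: power_Suc)
  finally show ?case
    by (simp only: q_pochhammer_self_Suc)
qed

text \<open>Dropping the positive term \<open>(1/2) ^ n\<close> leaves a bound free of
  \<open>n\<close>, which passes to the limit and reduces the infinite product to a finite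
  computation.\<close>

lemma q_pochhammer_inf_half_ge:
  "q_pochhammer (1/2) (1/2) N * (1 - (1/2) ^ N) \<le> q_pochhammer_inf (1/2) (1/2)"
proof (rule LIMSEQ_le_const [OF q_pochhammer_self_LIMSEQ])
  have "q_pochhammer (1/2) (1/2) N * (1 - (1/2) ^ N) \<le> q_pochhammer (1/2) (1/2) n" if "N \<le> n" for n
    by (rule order_trans [OF mult_left_mono q_pochhammer_half_ge [OF that]])
      (auto intro: less_imp_le [OF q_pochhammer_self_pos])
  then show "\<exists>M. \<forall>n\<ge>M. q_pochhammer (1/2) (1/2) N * (1 - (1/2) ^ N) \<le> q_pochhammer (1/2) (1/2) n"
    by blast
qed auto

lemma q_pochhammer_inf_half_gt: "2 * q_pochhammer_inf (1/2) (1/2) > 0.577576"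
proof -
  \<comment> \<open>The true value is about 0.57757619, a margin of roughly 2e-7. The error of the
    bound is of order 4^(-N), so N = 16 suffices comfortably, and 16 rational factors are multiplied
    out exactly.\<close>
  have "0.577576 < 2 * (q_pochhammer (1/2) (1/2) 16 * (1 - (1/2) ^ 16))"
    by (simp add: q_pochhammer_def numeral_eq_Suc prod.lessThan_Suc power_divide)
  with q_pochhammer_inf_half_ge [of 16] show ?thesis
    by linarith
qed

lemma q_pochhammer_self_div:
  assumes "0 \<le> x" "x < 1" "e \<le> k"
  shows "q_pochhammer x x k / q_pochhammer x x e = (\<Prod>i\<in>{e<..k}. 1 - x ^ i)"
proof -
  have "{1..k} = {1..e} \<union> {e<..k}"
    using assms(3) by auto
  then have "q_pochhammer x x k = q_pochhammer x x e * (\<Prod>i\<in>{e<..k}. 1 - x ^ i)"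
    by (simp only: q_pochhammer_self_eq_prod) (rule prod.union_disjoint, auto)
  then show ?thesis
    using q_pochhammer_self_pos [OF assms(1,2), of e] by simp
qed

lemma mrd_anticode_ratio_eq_prod:
  assumes "q \<ge> 2" "e < k" "k \<le> v" "d div 2 = Suc e"
  shows "mrd_anticode_ratio q k d v =
    (\<Prod>i\<in>{e<..k}. (1 - (1 / real q) ^ i) / (1 - (1 / real q) ^ (v - k + i)))"
proof -
  define m where "m = v - k"
  define F where "F = (\<lambda>i. (real q ^ (m + i) - 1) / (real q ^ i - 1))"
  have q: "real q > 1"
    using assms(1) by simp
  have pow: "real q ^ i > 1" if "i \<ge> 1" for i
    using q that by (intro one_less_power) auto
  have F_pos: "F i > 0" if "i \<ge> 1" for i
    using pow [of i] pow [of "m + i"] that by (simp add: F_def)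
  have "{1..k} = {1..e} \<union> {e<..k}"
    using assms(2) by auto
  then have "prod F {1..k} = prod F {1..e} * prod F {e<..k}"
    by (metis finite_atLeastAtMost finite_greaterThanAtMost ivl_disj_int_two(8) prod.union_disjoint)
  moreover have "prod F {1..e} > 0"
    by (intro prod_pos) (simp add: F_pos)
  \<comment> \<open>The second binomial has upper entry \<open>m + e\<close> and lower entry
    \<open>e\<close>, so its factors are the same \<open>F i\<close>, for i \<le> e.\<close>
  moreover have "anticode_bound q k d v = prod F {1..k} / prod F {1..e}"
    using assms(4) by (simp add: anticode_bound_def q_binomial_def m_def F_def)
  ultimately have "anticode_bound q k d v = prod F {e<..k}"
    by (metis less_irrefl nonzero_mult_div_cancel_left)
  \<comment> \<open>The exponent is \<open>m * (k - e)\<close> and \<open>{e<..k}\<close> has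
    \<open>k - e\<close> elements: one power \<open>real q ^ m\<close> for each remaining
    factor.\<close>
  moreover have "lifted_mrd_size q k d v = (\<Prod>i\<in>{e<..k}. real q ^ m)"
    using assms(2,4) by (simp add: lifted_mrd_size_def m_def Suc_diff_Suc flip: power_mult)
  ultimately have "mrd_anticode_ratio q k d v = (\<Prod>i\<in>{e<..k}. real q ^ m / F i)"
    by (simp add: mrd_anticode_ratio_def prod_dividef)
  also have "\<dots> = (\<Prod>i\<in>{e<..k}. (1 - (1 / real q) ^ i) / (1 - (1 / real q) ^ (m + i)))"
  proof (rule prod.cong)
    fix i assume "i \<in> {e<..k}"
    then have "real q ^ i > 1" "real q ^ (m + i) > 1"
      using pow by auto
    \<comment> \<open>Numerator and denominator are divided by
      \<open>real q ^ (m + i)\<close>.\<close>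
    then show "real q ^ m / F i = (1 - (1 / real q) ^ i) / (1 - (1 / real q) ^ (m + i))"
      using q by (simp add: F_def power_divide power_add divide_simps)
  qed simp
  finally show ?thesis
    by (simp add: m_def)
qed

lemma mrd_anticode_ratio_antimono:
  assumes "q \<ge> 2" "e < k" "d div 2 = Suc e"
  shows "antimono_on {k..} (mrd_anticode_ratio q k d)"
proof (rule monotone_onI)
  fix v w :: nat
  assume vw: "v \<in> {k..}" "w \<in> {k..}" "v \<le> w"
  let ?x = "1 / real q"
  have x: "0 < ?x" "?x < 1"
    using assms(1) by auto
  \<comment> \<open>Only the denominators depend on the dimension, and they grow with it.
    Nonnegativity is what allows the factorwise inequalities to be multiplied.\<close>
  have "(1 - ?x ^ i) / (1 - ?x ^ (w - k + i)) \<le> (1 - ?x ^ i) / (1 - ?x ^ (v - k + i))"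
    and "0 \<le> (1 - ?x ^ i) / (1 - ?x ^ (w - k + i))" if "e < i" for i
  proof -
    have "?x ^ i < 1" "?x ^ (v - k + i) < 1" "?x ^ (w - k + i) \<le> ?x ^ (v - k + i)"
      using x that vw by (auto simp: power_less_one_iff simp del: power_divide intro!: power_decreasing)
    then show "(1 - ?x ^ i) / (1 - ?x ^ (w - k + i)) \<le> (1 - ?x ^ i) / (1 - ?x ^ (v - k + i))"
      and "0 \<le> (1 - ?x ^ i) / (1 - ?x ^ (w - k + i))"
      by (auto intro!: divide_left_mono mult_pos_pos divide_nonneg_nonneg simp del: power_divide)
  qed
  then show "mrd_anticode_ratio q k d w \<le> mrd_anticode_ratio q k d v"
    using assms vw by (auto simp only: mrd_anticode_ratio_eq_prod atLeast_iff greaterThanAtMost_iff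
        intro!: prod_mono)
qed

lemma mrd_anticode_ratio_LIMSEQ:
  assumes "q \<ge> 2" "e < k" "d div 2 = Suc e"
  shows "mrd_anticode_ratio q k d \<longlonglongrightarrow>
    q_pochhammer (1 / real q) (1 / real q) k / q_pochhammer (1 / real q) (1 / real q) e"
proof -
  let ?x = "1 / real q"
  have x: "0 \<le> ?x" "?x < 1"
    using assms(1) by auto
  have "(\<lambda>v. ?x ^ (v - k + i)) \<longlonglongrightarrow> 0" for i
  \<comment> \<open>Shifting \<open>v\<close> by \<open>k\<close> removes the truncated
    subtraction.\<close>
  proof (rule LIMSEQ_offset [where k = k])
    have "(\<lambda>v. ?x ^ (v + i)) \<longlonglongrightarrow> 0"
      by (rule LIMSEQ_ignore_initial_segment [OF LIMSEQ_power_zero]) (use x in simp)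
    then show "(\<lambda>v. ?x ^ (v + k - k + i)) \<longlonglongrightarrow> 0"
      by simp
  qed
  then have "(\<lambda>v. \<Prod>i\<in>{e<..k}. (1 - ?x ^ i) / (1 - ?x ^ (v - k + i)))
      \<longlonglongrightarrow> (\<Prod>i\<in>{e<..k}. (1 - ?x ^ i) / (1 - 0))"
    by (intro tendsto_intros) auto
  moreover have "\<forall>\<^sub>F v in sequentially.
      (\<Prod>i\<in>{e<..k}. (1 - ?x ^ i) / (1 - ?x ^ (v - k + i))) = mrd_anticode_ratio q k d v"
    using eventually_ge_at_top [of k]
    by eventually_elim (use assms mrd_anticode_ratio_eq_prod in metis)
  ultimately have "mrd_anticode_ratio q k d \<longlonglongrightarrow> (\<Prod>i\<in>{e<..k}. (1 - ?x ^ i) / (1 - 0))"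
    by (rule Lim_transform_eventually)
  then show ?thesis
    using q_pochhammer_self_div [OF x less_imp_le [OF assms(2)]] by simp
qed

text \<open>The prefactors q/(q-1) and 2 are both 1/(1-x), at x = 1/q and x = 1/2. Cancelling the
  first factor this way makes the two sides comparable factor by factor.\<close>

lemma q_pochhammer_self_div_one_minus:
  assumes "0 \<le> x" "x < 1" "1 \<le> k"
  shows "q_pochhammer x x k / (1 - x) = (\<Prod>i\<in>{1<..k}. 1 - x ^ i)"
  using q_pochhammer_self_div [OF assms] by (simp add: q_pochhammer_self_eq_prod)

theorem proposition8:
  fixes q k d :: nat
  assumes "primepow q" and "k \<ge> 2" and "even d" and "4 \<le> d" and "d \<le> 2 * k"
  shows "antimono_on {2 * k..} (mrd_anticode_ratio q k d) \<and>
    mrd_anticode_ratio q k d \<longlonglongrightarrow>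
           q_pochhammer (1 / real q) (1 / real q) k
             / q_pochhammer (1 / real q) (1 / real q) (d div 2 - 1) \<and>
    (q_pochhammer (1 / real q) (1 / real q) k
             / q_pochhammer (1 / real q) (1 / real q) (d div 2 - 1)
           \<ge> real q / (real q - 1) * q_pochhammer (1 / real q) (1 / real q) k) \<and>
    (real q / (real q - 1) * q_pochhammer (1 / real q) (1 / real q) k
           \<ge> 2 * q_pochhammer_inf (1 / 2) (1 / 2)) \<and>
    2 * q_pochhammer_inf (1 / 2) (1 / 2) > 0.577576"
proof (intro conjI)
  define e where "e = d div 2 - 1"
  have e: "1 \<le> e" "e < k" "d div 2 = Suc e"
    using assms by (auto simp: e_def)
  have q: "q \<ge> 2"
    using primepow_gt_Suc_0 [OF assms(1)] by simp
  let ?x = "1 / real q"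
  have x: "0 \<le> ?x" "?x < 1" "?x \<le> 1/2"
    using q by (auto simp: field_simps)
  have factor: "real q / (real q - 1) * p = p / (1 - ?x)" for p
    using q by (simp add: field_simps)
  show "antimono_on {2 * k..} (mrd_anticode_ratio q k d)"
    by (rule monotone_on_subset [OF mrd_anticode_ratio_antimono [OF q e(2,3)]]) auto
  show "mrd_anticode_ratio q k d \<longlonglongrightarrow> q_pochhammer ?x ?x k / q_pochhammer ?x ?x (d div 2 - 1)"
    using mrd_anticode_ratio_LIMSEQ [OF q e(2,3)] by (simp only: e_def)
  \<comment> \<open>Here \<open>4 \<le> d\<close> enters, through \<open>1 \<le> e\<close>.\<close>
  have "q_pochhammer ?x ?x e \<le> q_pochhammer ?x ?x 1"
    by (rule antimonoD [OF q_pochhammer_self_antimono [OF x(1,2)] e(1)])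
  also have "\<dots> = 1 - ?x"
    by (simp add: q_pochhammer_def)
  finally have "q_pochhammer ?x ?x e \<le> 1 - ?x" .
  then show "q_pochhammer ?x ?x k / q_pochhammer ?x ?x (d div 2 - 1)
      \<ge> real q / (real q - 1) * q_pochhammer ?x ?x k"
    unfolding factor e_def [symmetric]
    using q_pochhammer_self_pos [OF x(1,2)] x
    by (intro divide_left_mono mult_pos_pos) (auto intro: less_imp_le)
  \<comment> \<open>The infinite product is first cut off at \<open>k\<close>, which can only
    increase it; then \<open>?x \<le> 1/2\<close> is used in each factor.\<close>
  have "2 * q_pochhammer_inf (1/2) (1/2) \<le> q_pochhammer (1/2) (1/2) k / (1 - 1/2)"
    using q_pochhammer_inf_self_le [of "1/2" k] by simp
  also have "\<dots> = (\<Prod>i\<in>{1<..k}. 1 - (1/2) ^ i)"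
    by (rule q_pochhammer_self_div_one_minus) (use assms(2) in auto)
  also have "\<dots> \<le> (\<Prod>i\<in>{1<..k}. 1 - ?x ^ i)"
    using x by (intro prod_mono conjI diff_left_mono power_mono) (auto simp: power_le_one)
  also have "\<dots> = real q / (real q - 1) * q_pochhammer ?x ?x k"
    unfolding factor
    by (rule q_pochhammer_self_div_one_minus [symmetric]) (use x assms(2) in auto)
  finally show "real q / (real q - 1) * q_pochhammer ?x ?x k \<ge> 2 * q_pochhammer_inf (1/2) (1/2)" .
  show "2 * q_pochhammer_inf (1/2) (1/2) > 0.577576"
    by (rule q_pochhammer_inf_half_gt)
qed

end
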